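(* In the calculus defined in the context, if $\Gamma\vdash M:A$ and $M$ is in normal form, then every subterm of $M$ has a type that is either a subformula of $A$, a subformula of a type in $\Gamma$, or a subformula of the type of a constant occurring in $M$.
   Context: **Types.** $A,B,C ::= \iota \mid A\to B \mid A\times B \mid A+B$, where $\iota$ ranges over base types. **Terms.** $L,M,N ::= x \mid c\,\overline{M} \mid \lambda x.N \mid L\,M \mid \mathbf{let}\ x=M\ \mathbf{in}\ N \mid (M,N) \mid \mathbf{fst}\,L \mid \mathbf{snd}\,L \mid \mathbf{inl}\,M \mid \mathbf{inr}\,N \mid \mathbf{case}\ L\ \mathbf{of}\ \{\mathbf{inl}\ x.M;\ \mathbf{inr}\ y.N\}$. Here $x,y,z$ range over variables and $c$ over (uninterpreted) constants. Each constant $c$ has an arity $k$ and a type $A_1\to\cdots\to A_k\to B$, and always occurs fully applied, $c\,M_1\cdots M_k$. Literals are represented as free variables. **Values.** $V,W ::= x \mid \lambda x.N \mid (V,W) \mid \mathbf{inl}\,V \mid \mathbf{inr}\,W$. In particular, constant applications are not values. Terms are identified up to renaming of bound variables. $FV(M)$ is the set of free variables of $M$, and $N[x:=M]$ is capture-avoiding substitution. **Typing.** $\Gamma\vdash M:A$, where the type environment $\Gamma$ pairs variables with types, is the standard simply typed judgement for functions, products, sums and (monomorphic) let. If $c:A_1\to\cdots\to A_k\to B$ has arity $k$ and $\Gamma\vdash M_i:A_i$ for all $i$, then $\Gamma\vdash c\,M_1\cdots M_k:B$. Type annotations on terms are suppressed; the type of a subterm of $M$ is the one it has in the typing derivation of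 $\Gamma\vdash M:A$. **Reductions.** Each $\mapsto_i$ is the compatible closure of the rules of phase $i$ below. *Phase 1.* Frames: $F ::= [\,]\,M \mid V\,[\,] \mid ([\,],M) \mid (V,[\,]) \mid \mathbf{fst}\,[\,] \mid \mathbf{snd}\,[\,] \mid \mathbf{inl}\,[\,] \mid \mathbf{inr}\,[\,] \mid \mathbf{case}\ [\,]\ \mathbf{of}\ \{\mathbf{inl}\ x.M;\ \mathbf{inr}\ y.N\}$. Rule: - $F[M]\mapsto_1 \mathbf{let}\ x=M\ \mathbf{in}\ F[x]$, with $x$ fresh and $M$ not a value. *Phase 2.* Frames: $G ::= \mathbf{let}\ x=[\,]\ \mathbf{in}\ N$. Rules: - $G[\mathbf{let}\ x=M\ \mathbf{in}\ N]\mapsto_2 \mathbf{let}\ x=M\ \mathbf{in}\ G[N]$, if $x\notin FV(G)$; - $G[\mathbf{case}\ V\ \mathbf{of}\ \{\mathbf{inl}\ x.M;\ \mathbf{inr}\ y.N\}]\mapsto_2 \mathbf{case}\ V\ \mathbf{of}\ \{\mathbf{inl}\ x.G[M];\ \mathbf{inr}\ y.G[N]\}$, if $x,y\notin FV(G)$; - $(\lambda x.N)\,V\mapsto_2 N[x:=V]$; - $\mathbf{fst}\,(V,W)\mapsto_2 V$; - $\mathbf{snd}\,(V,W)\mapsto_2 W$; - $\mathbf{case}\ (\mathbf{inl}\,V)\ \mathbf{of}\ \{\mathbf{inl}\ x.M;\ \mathbf{inr}\ y.N\}\mapsto_2 M[x:=V]$; - $\mathbf{case}\ (\mathbf{inr}\,W)\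 \mathbf{of}\ \{\mathbf{inl}\ x.M;\ \mathbf{inr}\ y.N\}\mapsto_2 N[y:=W]$; - $\mathbf{let}\ x=V\ \mathbf{in}\ N\mapsto_2 N[x:=V]$. *Phase 3.* Rule: - $\mathbf{let}\ x=M\ \mathbf{in}\ N\mapsto_3 N$, if $x\notin FV(N)$. The normalisation procedure applies the Phase 1 reductions exhaustively, then Phase 2, then Phase 3 (Phase 3 is omitted if the intended semantics is call-by-value rather than call-by-need). A term is in **normal form** if no reduction of these phases applies to it. **Subformulas.** The subformulas of a type are the type itself and the subformulas of its components (the components of $A\to B$, $A\times B$, $A+B$ are $A$ and $B$; base types have none). The type $A_1\to\cdots\to A_k\to B$ of a constant of arity $k$ is treated specially: its subformulas are itself and the subformulas of $A_1,\dots,A_k$ and $B$ (but not $A_i\to\cdots\to A_k\to B$ for $i>1$ as such). **Subterms.** The subterms of a term are the term itself and the subterms of its components (e.g. the subterms of $\lambda x.N$ are itself and the subterms of $N$; those of $L\,M$ are itself and the subterms of $L$ and $M$). The subterms of a constant application $c\,M_1\cdots M_k$ (arity $k$) are itself and the subterms of $M_1,\dots,M_k$ (but not $c\,M_1\cdots M_j$ for $j<k$). Free variables are equivalent to constants of arity zero. *)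

theory Defs
  imports Main
begin

text \<open>Base types are drawn from \<open>'b\<close>, constants from \<open>'c\<close>.  Terms are in de Bruijn
  notation, which identifies terms up to renaming of bound variables; freshness conditions turn
  into \<open>lift\<close>.  Under \<open>n\<close> binders, index \<open>n + i\<close> is the free variable \<open>i\<close>.\<close>

datatype 'b ty =
    Base 'b
  | Arrow "'b ty" "'b ty"
  | Product "'b ty" "'b ty"
  | Coproduct "'b ty" "'b ty"

text \<open>Index 0 is bound in \<open>N\<close> of \<open>Lam N\<close> and \<open>LetIn M N\<close>, and in both branches of
  \<open>CaseOf L M N\<close>.\<close>

datatype 'c tm =
    Var nat
  | Con 'c "'c tm list"
  | Lam "'c tm"
  | App "'c tm" "'c tm"
  | LetIn "'c tm" "'c tm"
  | MkPair "'c tm" "'c tm"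
  | Fst "'c tm"
  | Snd "'c tm"
  | InL "'c tm"
  | InR "'c tm"
  | CaseOf "'c tm" "'c tm" "'c tm"

text \<open>\<open>sig c = ([A\<^sub>1, \<dots>, A\<^sub>k], B)\<close> says that \<open>c\<close> has arity \<open>k\<close> and type
  \<open>A\<^sub>1 \<rightarrow> \<dots> \<rightarrow> A\<^sub>k \<rightarrow> B\<close>; \<open>B\<close> may itself be a function type.\<close>

type_synonym ('b, 'c) signature = "'c \<Rightarrow> 'b ty list \<times> 'b ty"

primrec lift :: "nat \<Rightarrow> 'c tm \<Rightarrow> 'c tm" where
  "lift k (Var i) = Var (if i < k then i else Suc i)"
| "lift k (Con c Ms) = Con c (map (lift k) Ms)"
| "lift k (Lam N) = Lam (lift (Suc k) N)"
| "lift k (App L M) = App (lift k L) (lift k M)"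
| "lift k (LetIn M N) = LetIn (lift k M) (lift (Suc k) N)"
| "lift k (MkPair M N) = MkPair (lift k M) (lift k N)"
| "lift k (Fst L) = Fst (lift k L)"
| "lift k (Snd L) = Snd (lift k L)"
| "lift k (InL M) = InL (lift k M)"
| "lift k (InR N) = InR (lift k N)"
| "lift k (CaseOf L M N) = CaseOf (lift k L) (lift (Suc k) M) (lift (Suc k) N)"

text \<open>\<open>subst k V N\<close> replaces index \<open>k\<close> by \<open>V\<close> in \<open>N\<close> and removes the binder of that index.\<close>

primrec subst :: "nat \<Rightarrow> 'c tm \<Rightarrow> 'c tm \<Rightarrow> 'c tm" where
  "subst k V (Var i) = (if i < k then Var i else if i = k then V else Var (i - 1))"
| "subst k V (Con c Ms) = Con c (map (subst k V) Ms)"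
| "subst k V (Lam N) = Lam (subst (Suc k) (lift 0 V) N)"
| "subst k V (App L M) = App (subst k V L) (subst k V M)"
| "subst k V (LetIn M N) = LetIn (subst k V M) (subst (Suc k) (lift 0 V) N)"
| "subst k V (MkPair M N) = MkPair (subst k V M) (subst k V N)"
| "subst k V (Fst L) = Fst (subst k V L)"
| "subst k V (Snd L) = Snd (subst k V L)"
| "subst k V (InL M) = InL (subst k V M)"
| "subst k V (InR N) = InR (subst k V N)"
| "subst k V (CaseOf L M N) =
     CaseOf (subst k V L) (subst (Suc k) (lift 0 V) M) (subst (Suc k) (lift 0 V) N)"

inductive is_value :: "'c tm \<Rightarrow> bool" where
  "is_value (Var i)"
| "is_value (Lam N)"
| "is_value V \<Longrightarrow> is_value W \<Longrightarrow> is_value (MkPair V W)"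
| "is_value V \<Longrightarrow> is_value (InL V)"
| "is_value W \<Longrightarrow> is_value (InR W)"


text \<open>The rules of \<open>phase1\<close> are the instances of \<open>F[M] \<mapsto> let x = M in F[x]\<close>, one for each
  frame \<open>F\<close>.\<close>

inductive phase1 :: "'c tm \<Rightarrow> 'c tm \<Rightarrow> bool" where
  "\<not> is_value L \<Longrightarrow> phase1 (App L M) (LetIn L (App (Var 0) (lift 0 M)))"
| "is_value V \<Longrightarrow> \<not> is_value M \<Longrightarrow> phase1 (App V M) (LetIn M (App (lift 0 V) (Var 0)))"
| "\<not> is_value M \<Longrightarrow> phase1 (MkPair M N) (LetIn M (MkPair (Var 0) (lift 0 N)))"
| "is_value V \<Longrightarrow> \<not> is_value M \<Longrightarrow> phase1 (MkPair V M) (LetIn M (MkPair (lift 0 V) (Var 0)))"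
| "\<not> is_value M \<Longrightarrow> phase1 (Fst M) (LetIn M (Fst (Var 0)))"
| "\<not> is_value M \<Longrightarrow> phase1 (Snd M) (LetIn M (Snd (Var 0)))"
| "\<not> is_value M \<Longrightarrow> phase1 (InL M) (LetIn M (InL (Var 0)))"
| "\<not> is_value M \<Longrightarrow> phase1 (InR M) (LetIn M (InR (Var 0)))"
| "\<not> is_value L \<Longrightarrow>
     phase1 (CaseOf L M N) (LetIn L (CaseOf (Var 0) (lift 1 M) (lift 1 N)))"

inductive phase2 :: "'c tm \<Rightarrow> 'c tm \<Rightarrow> bool" where
  "phase2 (LetIn (LetIn M N) P) (LetIn M (LetIn N (lift 1 P)))"
| "is_value V \<Longrightarrow>
     phase2 (LetIn (CaseOf V M N) P) (CaseOf V (LetIn M (lift 1 P)) (LetIn N (lift 1 P)))"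
| "is_value V \<Longrightarrow> phase2 (App (Lam N) V) (subst 0 V N)"
| "is_value V \<Longrightarrow> is_value W \<Longrightarrow> phase2 (Fst (MkPair V W)) V"
| "is_value V \<Longrightarrow> is_value W \<Longrightarrow> phase2 (Snd (MkPair V W)) W"
| "is_value V \<Longrightarrow> phase2 (CaseOf (InL V) M N) (subst 0 V M)"
| "is_value W \<Longrightarrow> phase2 (CaseOf (InR W) M N) (subst 0 W N)"
| "is_value V \<Longrightarrow> phase2 (LetIn V N) (subst 0 V N)"

text \<open>The terms in which index 0 is not free are exactly those of the form \<open>lift 0 N\<close>.\<close>

inductive phase3 :: "'c tm \<Rightarrow> 'c tm \<Rightarrow> bool" where
  "phase3 (LetIn M (lift 0 N)) N"

inductive compatible_closure :: "('c tm \<Rightarrow> 'c tm \<Rightarrow> bool) \<Rightarrow> 'c tm \<Rightarrow> 'c tm \<Rightarrow> bool"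
  for R :: "'c tm \<Rightarrow> 'c tm \<Rightarrow> bool" where
  "R M M' \<Longrightarrow> compatible_closure R M M'"
| "compatible_closure R M M' \<Longrightarrow>
     compatible_closure R (Con c (Ms @ M # Ns)) (Con c (Ms @ M' # Ns))"
| "compatible_closure R N N' \<Longrightarrow> compatible_closure R (Lam N) (Lam N')"
| "compatible_closure R L L' \<Longrightarrow> compatible_closure R (App L M) (App L' M)"
| "compatible_closure R M M' \<Longrightarrow> compatible_closure R (App L M) (App L M')"
| "compatible_closure R M M' \<Longrightarrow> compatible_closure R (LetIn M N) (LetIn M' N)"
| "compatible_closure R N N' \<Longrightarrow> compatible_closure R (LetIn M N) (LetIn M N')"
| "compatible_closure R M M' \<Longrightarrow> compatible_closure R (MkPair M N) (MkPair M' N)"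
| "compatible_closure R N N' \<Longrightarrow> compatible_closure R (MkPair M N) (MkPair M N')"
| "compatible_closure R L L' \<Longrightarrow> compatible_closure R (Fst L) (Fst L')"
| "compatible_closure R L L' \<Longrightarrow> compatible_closure R (Snd L) (Snd L')"
| "compatible_closure R M M' \<Longrightarrow> compatible_closure R (InL M) (InL M')"
| "compatible_closure R N N' \<Longrightarrow> compatible_closure R (InR N) (InR N')"
| "compatible_closure R L L' \<Longrightarrow> compatible_closure R (CaseOf L M N) (CaseOf L' M N)"
| "compatible_closure R M M' \<Longrightarrow> compatible_closure R (CaseOf L M N) (CaseOf L M' N)"
| "compatible_closure R N N' \<Longrightarrow> compatible_closure R (CaseOf L M N) (CaseOf L M N')"

text \<open>The third phase belongs to the normalisation procedure only under call-by-need.\<close>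

datatype semantics = Call_by_need | Call_by_value

fun phases :: "semantics \<Rightarrow> ('c tm \<Rightarrow> 'c tm \<Rightarrow> bool) set" where
  "phases Call_by_need = {phase1, phase2, phase3}"
| "phases Call_by_value = {phase1, phase2}"

definition normal_form :: "semantics \<Rightarrow> 'c tm \<Rightarrow> bool" where
  "normal_form s M \<longleftrightarrow> (\<forall>R \<in> phases s. \<nexists>N. compatible_closure R M N)"


text \<open>An environment gives the free variable \<open>i\<close> the type \<open>\<Gamma> ! i\<close>.  Since terms carry no type
  annotations, a judgement \<open>\<Gamma> \<turnstile> M : A\<close> can have several derivations giving different
  types to the same subterm.  Derivations are therefore made explicit, as trees of judgements:
  \<open>typing_derivation sig \<Gamma> M A D\<close> says that \<open>D\<close> is a derivation of \<open>\<Gamma> \<turnstile> M : A\<close>.\<close>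

datatype ('b, 'c) deriv = Deriv "'b ty list" "'c tm" "'b ty" "('b, 'c) deriv list"

inductive typing_derivation ::
  "('b, 'c) signature \<Rightarrow> 'b ty list \<Rightarrow> 'c tm \<Rightarrow> 'b ty \<Rightarrow> ('b, 'c) deriv \<Rightarrow> bool"
  for sig :: "('b, 'c) signature" where
  Var: "i < length \<Gamma> \<Longrightarrow> \<Gamma> ! i = A \<Longrightarrow>
     typing_derivation sig \<Gamma> (Var i) A (Deriv \<Gamma> (Var i) A [])"
| Con: "sig c = (As, B) \<Longrightarrow> length Ms = length As \<Longrightarrow> length Ds = length As \<Longrightarrow>
     (\<forall>i < length As. typing_derivation sig \<Gamma> (Ms ! i) (As ! i) (Ds ! i)) \<Longrightarrow>
     typing_derivation sig \<Gamma> (Con c Ms) B (Deriv \<Gamma> (Con c Ms) B Ds)"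
| Lam: "typing_derivation sig (A # \<Gamma>) N B D \<Longrightarrow>
     typing_derivation sig \<Gamma> (Lam N) (Arrow A B) (Deriv \<Gamma> (Lam N) (Arrow A B) [D])"
| App: "typing_derivation sig \<Gamma> L (Arrow A B) D \<Longrightarrow> typing_derivation sig \<Gamma> M A E \<Longrightarrow>
     typing_derivation sig \<Gamma> (App L M) B (Deriv \<Gamma> (App L M) B [D, E])"
| LetIn: "typing_derivation sig \<Gamma> M A D \<Longrightarrow> typing_derivation sig (A # \<Gamma>) N B E \<Longrightarrow>
     typing_derivation sig \<Gamma> (LetIn M N) B (Deriv \<Gamma> (LetIn M N) B [D, E])"
| MkPair: "typing_derivation sig \<Gamma> M A D \<Longrightarrow> typing_derivation sig \<Gamma> N B E \<Longrightarrow>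
     typing_derivation sig \<Gamma> (MkPair M N) (Product A B)
       (Deriv \<Gamma> (MkPair M N) (Product A B) [D, E])"
| Fst: "typing_derivation sig \<Gamma> L (Product A B) D \<Longrightarrow>
     typing_derivation sig \<Gamma> (Fst L) A (Deriv \<Gamma> (Fst L) A [D])"
| Snd: "typing_derivation sig \<Gamma> L (Product A B) D \<Longrightarrow>
     typing_derivation sig \<Gamma> (Snd L) B (Deriv \<Gamma> (Snd L) B [D])"
| InL: "typing_derivation sig \<Gamma> M A D \<Longrightarrow>
     typing_derivation sig \<Gamma> (InL M) (Coproduct A B) (Deriv \<Gamma> (InL M) (Coproduct A B) [D])"
| InR: "typing_derivation sig \<Gamma> N B D \<Longrightarrow>
     typing_derivation sig \<Gamma> (InR N) (Coproduct A B) (Deriv \<Gamma> (InR N) (Coproduct A B) [D])"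
| CaseOf: "typing_derivation sig \<Gamma> L (Coproduct A B) D \<Longrightarrow>
     typing_derivation sig (A # \<Gamma>) M C E \<Longrightarrow> typing_derivation sig (B # \<Gamma>) N C F \<Longrightarrow>
     typing_derivation sig \<Gamma> (CaseOf L M N) C (Deriv \<Gamma> (CaseOf L M N) C [D, E, F])"


primrec subterms :: "'c tm \<Rightarrow> 'c tm set" where
  "subterms (Var i) = {Var i}"
| "subterms (Con c Ms) = insert (Con c Ms) (\<Union> (set (map subterms Ms)))"
| "subterms (Lam N) = insert (Lam N) (subterms N)"
| "subterms (App L M) = insert (App L M) (subterms L \<union> subterms M)"
| "subterms (LetIn M N) = insert (LetIn M N) (subterms M \<union> subterms N)"
| "subterms (MkPair M N) = insert (MkPair M N) (subterms M \<union> subterms N)"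
| "subterms (Fst L) = insert (Fst L) (subterms L)"
| "subterms (Snd L) = insert (Snd L) (subterms L)"
| "subterms (InL M) = insert (InL M) (subterms M)"
| "subterms (InR N) = insert (InR N) (subterms N)"
| "subterms (CaseOf L M N) = insert (CaseOf L M N) (subterms L \<union> subterms M \<union> subterms N)"

definition constants :: "'c tm \<Rightarrow> 'c set" where
  "constants M = {c. \<exists>Ms. Con c Ms \<in> subterms M}"

text \<open>The nodes of a derivation of \<open>\<Gamma> \<turnstile> M : A\<close> correspond one-to-one to the occurrences of
  subterms in \<open>M\<close>, so this collects each subterm of \<open>M\<close> with the type that each of its
  occurrences has in the derivation.\<close>

primrec typed_subterms :: "('b, 'c) deriv \<Rightarrow> ('c tm \<times> 'b ty) set" where
  "typed_subterms (Deriv \<Gamma> M A Ds) = insert (M, A) (\<Union> (set (map typed_subterms Ds)))"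

primrec subformulas :: "'b ty \<Rightarrow> 'b ty set" where
  "subformulas (Base b) = {Base b}"
| "subformulas (Arrow A B) = insert (Arrow A B) (subformulas A \<union> subformulas B)"
| "subformulas (Product A B) = insert (Product A B) (subformulas A \<union> subformulas B)"
| "subformulas (Coproduct A B) = insert (Coproduct A B) (subformulas A \<union> subformulas B)"

definition const_subformulas :: "('b, 'c) signature \<Rightarrow> 'c \<Rightarrow> 'b ty set" where
  "const_subformulas sig c =
     (case sig c of (As, B) \<Rightarrow>
        {foldr Arrow As B} \<union> (\<Union>A \<in> set As. subformulas A) \<union> subformulas B)"

end

theory Submission
  imports Defs
begin

text \<open>In a typed normal form every eliminated term is a variable, and every term bound by a let
  is an application of a variable, a projection of a variable, or an application of a constant: a
  let or a case there would be a phase 2 redex.  Hence the types synthesised by eliminations come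
  from the environment or from a constant, while all other types are dictated from outside, by
  the type of the whole term, of a variable, or of a constant.\<close>

lemma subformulas_refl [simp]: "A \<in> subformulas A"
  by (cases A) simp_all

lemma subformulas_trans: "B \<in> subformulas A \<Longrightarrow> C \<in> subformulas B \<Longrightarrow> C \<in> subformulas A"
  by (induction A) auto

lemma constants_simps [simp]:
  "constants (Var i) = {}"
  "constants (Con c Ms) = insert c (\<Union>M \<in> set Ms. constants M)"
  "constants (Lam M) = constants M"
  "constants (App L M) = constants L \<union> constants M"
  "constants (LetIn M N) = constants M \<union> constants N"
  "constants (MkPair M N) = constants M \<union> constants N"
  "constants (Fst M) = constants M"
  "constants (Snd M) = constants M"
  "constants (InL M) = constants M"
  "constants (InR M) = constants M"
  "constants (CaseOf L M N) = constants L \<union> constants M \<union> constants N"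
  by (auto simp: constants_def)

text \<open>Needed so that the bound on all types of the occurrences of \<open>N\<close> is not
  vacuous: the derivation has a node for each subterm.\<close>

lemma subterm_has_type:
  "typing_derivation sig \<Gamma> M A D \<Longrightarrow> N \<in> subterms M \<Longrightarrow> \<exists>B. (N, B) \<in> typed_subterms D"
proof (induction rule: typing_derivation.induct)
  case (Con c As B Ms Ds \<Gamma>)
  show ?case
  proof (cases "N = Con c Ms")
    case False
    with Con.prems obtain i where "i < length Ms" "N \<in> subterms (Ms ! i)"
      by (auto simp: in_set_conv_nth)
    with Con.IH Con.hyps obtain B' where "(N, B') \<in> typed_subterms (Ds ! i)" by auto
    moreover from \<open>i < length Ms\<close> Con.hyps have "Ds ! i \<in> set Ds" by simp
    ultimately show ?thesis by auto
  qed auto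
qed auto

text \<open>Phases 1 and 2 belong to both semantics, so the argument from here on is uniform in
  \<open>s\<close>.\<close>

lemma normal_form_not_phase1: "normal_form s M \<Longrightarrow> \<not> phase1 M N"
  by (cases s) (auto simp: normal_form_def intro: compatible_closure.intros(1))

lemma normal_form_not_phase2: "normal_form s M \<Longrightarrow> \<not> phase2 M N"
  by (cases s) (auto simp: normal_form_def intro: compatible_closure.intros(1))

lemma normal_form_components:
  "normal_form s (Lam M) \<Longrightarrow> normal_form s M"
  "normal_form s (App L M) \<Longrightarrow> normal_form s L \<and> normal_form s M"
  "normal_form s (LetIn M N) \<Longrightarrow> normal_form s M \<and> normal_form s N"
  "normal_form s (MkPair M N) \<Longrightarrow> normal_form s M \<and> normal_form s N"
  "normal_form s (Fst M) \<Longrightarrow> normal_form s M"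
  "normal_form s (Snd M) \<Longrightarrow> normal_form s M"
  "normal_form s (InL M) \<Longrightarrow> normal_form s M"
  "normal_form s (InR M) \<Longrightarrow> normal_form s M"
  "normal_form s (CaseOf L M N) \<Longrightarrow> normal_form s L \<and> normal_form s M \<and> normal_form s N"
  unfolding normal_form_def by (blast intro: compatible_closure.intros)+

lemma normal_form_Con_arg: "normal_form s (Con c Ms) \<Longrightarrow> M \<in> set Ms \<Longrightarrow> normal_form s M"
  unfolding normal_form_def by (metis compatible_closure.intros(2) split_list)

text \<open>Among values only variables and abstractions can have an arrow type. An abstraction is
  excluded by beta, which fires only on a value argument; hence phase 1 is applied to
  \<open>M\<close> as well as to \<open>L\<close>.\<close>

lemma normal_form_App_Var:
  assumes "normal_form s (App L M)" and "typing_derivation sig \<Gamma> L (Arrow A B) D"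
  obtains i where "L = Var i"
proof -
  have "is_value L" "is_value M"
    using normal_form_not_phase1[OF assms(1)] by (blast intro: phase1.intros)+
  then have "L \<noteq> Lam N" for N
    using normal_form_not_phase2[OF assms(1)] by (blast intro: phase2.intros)
  with \<open>is_value L\<close> assms(2) that show thesis
    by (auto elim: is_value.cases typing_derivation.cases)
qed

text \<open>A value of product type is a variable or a pair of values, and projecting from such a
  pair is a phase 2 redex.\<close>

lemma normal_form_Fst_Var:
  assumes "normal_form s (Fst L)" and "typing_derivation sig \<Gamma> L (Product A B) D"
  obtains i where "L = Var i"
proof -
  have "is_value L"
    using normal_form_not_phase1[OF assms(1)] by (blast intro: phase1.intros)
  moreover have "\<not> (is_value V \<and> is_value W \<and> L = MkPair V W)" for V W
    using normal_form_not_phase2[OF assms(1)] by (blast intro: phase2.intros)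
  ultimately show thesis
    using assms(2) that by (auto elim: is_value.cases typing_derivation.cases)
qed

lemma normal_form_Snd_Var:
  assumes "normal_form s (Snd L)" and "typing_derivation sig \<Gamma> L (Product A B) D"
  obtains i where "L = Var i"
proof -
  have "is_value L"
    using normal_form_not_phase1[OF assms(1)] by (blast intro: phase1.intros)
  moreover have "\<not> (is_value V \<and> is_value W \<and> L = MkPair V W)" for V W
    using normal_form_not_phase2[OF assms(1)] by (blast intro: phase2.intros)
  ultimately show thesis
    using assms(2) that by (auto elim: is_value.cases typing_derivation.cases)
qed

text \<open>Kept apart from the typed version because moving a let into the branches of a case
  requires only that the scrutinee be a value.\<close>

lemma normal_form_CaseOf_value: "normal_form s (CaseOf L M N) \<Longrightarrow> is_value L"
  using normal_form_not_phase1 by (blast intro: phase1.intros)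

lemma normal_form_CaseOf_Var:
  assumes "normal_form s (CaseOf L M N)" and "typing_derivation sig \<Gamma> L (Coproduct A B) D"
  obtains i where "L = Var i"
proof -
  have "\<not> (is_value V \<and> (L = InL V \<or> L = InR V))" for V
    using normal_form_not_phase2[OF assms(1)] by (blast intro: phase2.intros)
  with normal_form_CaseOf_value[OF assms(1)] assms(2) that show thesis
    by (auto elim: is_value.cases typing_derivation.cases)
qed

lemma typing_derivation_Var: "typing_derivation sig \<Gamma> (Var i) A D \<Longrightarrow> A \<in> set \<Gamma>"
  by (auto elim: typing_derivation.cases)

text \<open>The typing rule for let shows the type of the bound term neither in the environment nor
  in the type of its conclusion. This cut type must therefore be recovered from the shape of the
  bound term.\<close>

lemma normal_form_let_bound_type:
  assumes "typing_derivation sig \<Gamma> M A D" and "normal_form s (LetIn M N)"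
    and env: "set \<Gamma> \<subseteq> S"
    and const_type: "\<And>c. c \<in> constants M \<Longrightarrow> snd (sig c) \<in> S"
    and closed: "\<And>B. B \<in> S \<Longrightarrow> subformulas B \<subseteq> S"
  shows "A \<in> S"
proof -
  note no_redex = normal_form_not_phase2[OF assms(2)]
  have nf: "normal_form s M"
    using assms(2) normal_form_components by blast
  have "\<not> is_value M"
    using no_redex by (blast intro: phase2.intros)
  show ?thesis
    using assms(1)
  proof cases
    case (App L B D' M' E)
    with nf have "Arrow B A \<in> set \<Gamma>"
      by (metis normal_form_App_Var typing_derivation_Var)
    with env closed show ?thesis by fastforce
  next
    case (Fst L B D')
    with nf have "Product A B \<in> set \<Gamma>"
      by (metis normal_form_Fst_Var typing_derivation_Var)
    with env closed show ?thesis by fastforce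
  next
    case (Snd L B D')
    with nf have "Product B A \<in> set \<Gamma>"
      by (metis normal_form_Snd_Var typing_derivation_Var)
    with env closed show ?thesis by fastforce
  next
    \<comment> \<open>Here and for a case, the redex is the enclosing let together with
      \<open>M\<close>, by a commuting conversion.\<close>
    case (LetIn M' B D' N' E)
    with no_redex show ?thesis by (blast intro: phase2.intros)
  next
    case (CaseOf L B C D' M' E N' F)
    with no_redex nf show ?thesis
      by (metis normal_form_CaseOf_value phase2.intros(2))
  next
    \<comment> \<open>A pair or injection that is not a value has a component that is not a value,
      which phase 1 would name by a let.\<close>
    case (MkPair M' B D' N' C E)
    with no_redex nf \<open>\<not> is_value M\<close> show ?thesis
      by (metis normal_form_not_phase1 phase1.intros(3,4) is_value.intros(3))
  next
    case (InL M' B D' C)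
    with nf \<open>\<not> is_value M\<close> show ?thesis
      by (metis normal_form_not_phase1 phase1.intros(7) is_value.intros(4))
  next
    case (InR M' B D' C)
    with nf \<open>\<not> is_value M\<close> show ?thesis
      by (metis normal_form_not_phase1 phase1.intros(8) is_value.intros(5))
  next
    case (Con c As Ms Ds)
    with const_type show ?thesis by fastforce
  qed (use \<open>\<not> is_value M\<close> in \<open>auto intro: is_value.intros\<close>)
qed

text \<open>Environment and type change as the induction descends. A fixed set \<open>S\<close>
  closed under subformulas makes the claim inductive, with membership of both in \<open>S\<close> as
  the invariant.\<close>

lemma normal_form_types_closed:
  assumes "typing_derivation sig \<Gamma> M A D" and "normal_form s M"
    and "set \<Gamma> \<subseteq> S" and "A \<in> S"
    and "\<And>c. c \<in> constants M \<Longrightarrow> set (fst (sig c)) \<subseteq> S \<and> snd (sig c) \<in> S"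
    and closed: "\<And>B. B \<in> S \<Longrightarrow> subformulas B \<subseteq> S"
  shows "snd ` typed_subterms D \<subseteq> S"
  using assms(1-5)
proof (induction rule: typing_derivation.induct)
  case (Con c As B Ms Ds \<Gamma>)
  have "snd ` typed_subterms D' \<subseteq> S" if "D' \<in> set Ds" for D'
  proof -
    from that Con.hyps obtain i where i: "i < length As" "D' = Ds ! i"
      by (auto simp: in_set_conv_nth)
    with Con.hyps have "Ms ! i \<in> set Ms" "As ! i \<in> set As" by auto
    \<comment> \<open>The argument types lie in \<open>S\<close> because \<open>c\<close> itself is
      among the constants of the term; the type \<open>B\<close> says nothing about them.\<close>
    with Con.prems Con.hyps have "normal_form s (Ms ! i)" "As ! i \<in> S"
      "\<And>c. c \<in> constants (Ms ! i) \<Longrightarrow> set (fst (sig c)) \<subseteq> S \<and> snd (sig c) \<in> S"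
      by (fastforce dest: normal_form_Con_arg)+
    with Con.IH Con.prems(2) i show ?thesis by blast
  qed
  with Con.prems(3) show ?case by fastforce
next
  case (Lam A \<Gamma> N B D)
  from closed[OF Lam.prems(3)] have "A \<in> S" "B \<in> S" by auto
  with Lam normal_form_components(1)[OF Lam.prems(1)] show ?case
    by simp
next
  case (App \<Gamma> L A B D M E)
  \<comment> \<open>The domain \<open>A\<close> cannot be read off the type \<open>B\<close> of the
    application, but it is part of the type of the variable in function position.\<close>
  from App.prems(1) App.hyps(1) have "Arrow A B \<in> set \<Gamma>"
    by (metis normal_form_App_Var typing_derivation_Var)
  with App.prems(2) have arrow: "Arrow A B \<in> S" by blast
  with closed have "A \<in> S" by fastforce
  with arrow App normal_form_components(2)[OF App.prems(1)] show ?case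
    by (simp add: image_Un)
next
  case (LetIn \<Gamma> M A D N B E)
  \<comment> \<open>This serves both induction hypotheses: \<open>A\<close> is the type of
    \<open>M\<close> and extends the environment of \<open>N\<close>.\<close>
  have "A \<in> S"
    using LetIn.hyps(1) LetIn.prems(1,2)
    by (rule normal_form_let_bound_type) (use LetIn.prems(4) closed in auto)
  with LetIn normal_form_components(3)[OF LetIn.prems(1)] show ?case
    by (simp add: image_Un)
next
  case (MkPair \<Gamma> M A D N B E)
  from closed[OF MkPair.prems(3)] have "A \<in> S" "B \<in> S" by auto
  with MkPair normal_form_components(4)[OF MkPair.prems(1)] show ?case
    by (simp add: image_Un)
next
  case (Fst \<Gamma> L A B D)
  from Fst.prems(1) Fst.hyps have "Product A B \<in> set \<Gamma>"
    by (metis normal_form_Fst_Var typing_derivation_Var)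
  with Fst normal_form_components(5)[OF Fst.prems(1)] show ?case
    by auto
next
  case (Snd \<Gamma> L A B D)
  from Snd.prems(1) Snd.hyps have "Product A B \<in> set \<Gamma>"
    by (metis normal_form_Snd_Var typing_derivation_Var)
  with Snd normal_form_components(6)[OF Snd.prems(1)] show ?case
    by auto
next
  case (InL \<Gamma> M A D B)
  from closed[OF InL.prems(3)] have "A \<in> S" by auto
  with InL normal_form_components(7)[OF InL.prems(1)] show ?case
    by simp
next
  case (InR \<Gamma> N B D A)
  from closed[OF InR.prems(3)] have "B \<in> S" by auto
  with InR normal_form_components(8)[OF InR.prems(1)] show ?case
    by simp
next
  case (CaseOf \<Gamma> L A B D M C E N F)
  from CaseOf.prems(1) CaseOf.hyps(1) have "Coproduct A B \<in> set \<Gamma>"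
    by (metis normal_form_CaseOf_Var typing_derivation_Var)
  with CaseOf.prems(2) have coproduct: "Coproduct A B \<in> S" by blast
  with closed have "A \<in> S" "B \<in> S" by fastforce+
  with coproduct CaseOf normal_form_components(9)[OF CaseOf.prems(1)] show ?case
    by (simp add: image_Un)
qed auto

theorem proposition4p2:
  fixes sig :: "('b, 'c) signature" and \<Gamma> :: "'b ty list" and M N :: "'c tm" and A :: "'b ty"
    and D :: "('b, 'c) deriv" and s :: semantics
  assumes "typing_derivation sig \<Gamma> M A D"
    and "normal_form s M"
    and "N \<in> subterms M"
  shows "(\<exists>B. (N, B) \<in> typed_subterms D) \<and>
    (\<forall>B. (N, B) \<in> typed_subterms D \<longrightarrow>
       B \<in> subformulas A \<or>
       (\<exists>C \<in> set \<Gamma>. B \<in> subformulas C) \<or>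
       (\<exists>c \<in> constants M. B \<in> const_subformulas sig c))"
proof (intro conjI allI impI)
  show "\<exists>B. (N, B) \<in> typed_subterms D"
    using assms(1,3) by (rule subterm_has_type)
next
  fix B
  assume "(N, B) \<in> typed_subterms D"
  txt \<open>The full type of a constant is left out of \<open>S\<close>: its proper suffixes are not among the
    subformulas of the constant, so with it \<open>S\<close> would not be closed.\<close>
  define S where "S = subformulas A \<union> (\<Union>C \<in> set \<Gamma>. subformulas C) \<union>
    (\<Union>c \<in> constants M. (\<Union>C \<in> set (fst (sig c)). subformulas C) \<union> subformulas (snd (sig c)))"
  \<comment> \<open>As a union of sets of the form \<open>subformulas C\<close>, \<open>S\<close> is
    closed by transitivity and contains each such \<open>C\<close> by reflexivity.\<close>
  have "snd ` typed_subterms D \<subseteq> S"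
    using assms(1,2)
    by (rule normal_form_types_closed) (auto simp: S_def intro: subformulas_trans subformulas_refl)
  with \<open>(N, B) \<in> typed_subterms D\<close> have "B \<in> S" by force
  moreover have "(\<Union>C \<in> set (fst (sig c)). subformulas C) \<union> subformulas (snd (sig c))
      \<subseteq> const_subformulas sig c" for c
    by (auto simp: const_subformulas_def split: prod.splits)
  ultimately show "B \<in> subformulas A \<or>
      (\<exists>C \<in> set \<Gamma>. B \<in> subformulas C) \<or>
      (\<exists>c \<in> constants M. B \<in> const_subformulas sig c)"
    unfolding S_def by blast
qed

end
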